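(* If $g(x)=\sum_{k=0}^{\infty} a_{2k+1}x^{2k+1}$, then $$\int_0^{\frac{\pi}{2}} g(\sin x)\,dx=\int_0^{\frac{\pi}{2}} g(\cos x)\,dx=a_1+\sum_{k=1}^{\infty} a_{2k+1}\,\frac{2\cdot 4\cdot\ldots\cdot(2k)}{1\cdot 3\cdot\ldots\cdot(2k+1)}.$$
   Context: Here $g$ is a function given by a power series in odd powers of $x$ with coefficients $a_{2k+1}$, $k\ge 0$. $2\cdot 4\cdot\ldots\cdot(2k)$ denotes the product of the first $k$ even positive integers and $1\cdot 3\cdot\ldots\cdot(2k+1)$ the product of the first $k+1$ odd positive integers. *)

theory Defs
  imports "HOL-Analysis.Analysis"
begin

definition even_odd_ratio :: "nat \<Rightarrow> real" where
  "even_odd_ratio k = (\<Prod>j=1..k. real (2 * j)) / (\<Prod>j=0..k. real (2 * j + 1))"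

end

theory Submission
  imports Defs
begin

text \<open>
  The hypothesis includes convergence at \<open>x = 1\<close>, that is, convergence of the coefficient
  series \<open>\<Sum> a\<^sub>2\<^sub>k\<^sub>+\<^sub>1\<close>, though possibly only conditionally. Abel's test then makes the
  power series converge uniformly on the closed interval \<open>[0,1]\<close>: its factors
  \<open>x\<^sup>2\<^sup>k\<^sup>+\<^sup>1\<close> lie in \<open>[0,1]\<close> and decrease in \<open>k\<close>, so summation by parts
  bounds every tail at \<open>x\<close> by the tails at \<open>1\<close>, independently of \<open>x\<close>
  (lemmas \<open>abs_sum_mult_antimono_le\<close> and \<open>uniform_limit_Abel_test\<close>).

  On \<open>[0, \<pi>/2]\<close> sine and cosine take values in \<open>[0,1]\<close>, so both compositions are uniform
  limits of continuous functions and may be integrated term by term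
  (\<open>integral_odd_power_series_compose\<close>). The summability of the resulting series is part of
  this conclusion; it is not clear beforehand, since the coefficients need not be
  absolutely summable. The integrals of the odd powers of sine are Wallis's
  (\<open>has_integral_sin_odd_power\<close>), and the reflection \<open>x \<mapsto> \<pi>/2 - x\<close> transfers them to cosine.
\<close>

text \<open>
  Abel's inequality. With \<open>B j\<close> for the partial sums of \<open>b\<close>, summation by parts writes the sum
  as \<open>B n * c n + (\<Sum>k<n. B (Suc k) * (c k - c (Suc k)))\<close>, in which every weight on a
  partial sum is nonnegative and the weights telescope to \<open>c 0\<close>.
\<close>

lemma abs_sum_mult_antimono_le:
  fixes b c :: "nat \<Rightarrow> real"
  assumes bound: "\<And>j. \<bar>\<Sum>k<j. b k\<bar> \<le> M"
    and anti: "antimono c" and nonneg: "\<And>k. 0 \<le> c k"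
  shows "\<bar>\<Sum>k<n. b k * c k\<bar> \<le> M * c 0"
proof -
  define B where "B j = (\<Sum>k<j. b k)" for j
  have parts: "(\<Sum>k<n. b k * c k) = B n * c n + (\<Sum>k<n. B (Suc k) * (c k - c (Suc k)))"
    by (induction n) (auto simp: B_def algebra_simps)
  have "\<bar>B n * c n\<bar> \<le> M * c n"
    using bound[of n] nonneg[of n] by (auto simp: B_def abs_mult intro: mult_right_mono)
  moreover have "\<bar>\<Sum>k<n. B (Suc k) * (c k - c (Suc k))\<bar> \<le> (\<Sum>k<n. M * (c k - c (Suc k)))"
  proof (rule order_trans[OF sum_abs sum_mono])
    fix k
    have "0 \<le> c k - c (Suc k)" using antimonoD[OF anti, of k "Suc k"] by simp
    then show "\<bar>B (Suc k) * (c k - c (Suc k))\<bar> \<le> M * (c k - c (Suc k))"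
      using bound[of "Suc k"] unfolding B_def abs_mult by (simp add: mult_right_mono)
  qed
  moreover have "(\<Sum>k<n. M * (c k - c (Suc k))) = M * c 0 - M * c n"
    unfolding sum_distrib_left[symmetric] sum_lessThan_telescope' by (rule right_diff_distrib)
  ultimately show ?thesis unfolding parts by linarith
qed

text \<open>
  The tail at any \<open>x\<close> is bounded by the partial sums of the tail of \<open>b\<close>, which the Cauchy
  criterion for \<open>b\<close> makes small independently of \<open>x\<close>.
\<close>

lemma uniform_limit_Abel_test:
  fixes b :: "nat \<Rightarrow> real" and c :: "nat \<Rightarrow> 'a \<Rightarrow> real"
  assumes summable: "summable b"
    and anti: "\<And>x. x \<in> X \<Longrightarrow> antimono (\<lambda>k. c k x)"
    and range: "\<And>k x. x \<in> X \<Longrightarrow> 0 \<le> c k x \<and> c k x \<le> 1"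
    and sums: "\<And>x. x \<in> X \<Longrightarrow> (\<lambda>k. b k * c k x) sums g x"
  shows "uniform_limit X (\<lambda>n x. \<Sum>k<n. b k * c k x) g sequentially"
  unfolding uniform_limit_sequentially_iff
proof (intro allI impI)
  fix e :: real assume "e > 0"
  then obtain N where N: "\<And>m n. m \<ge> N \<Longrightarrow> \<bar>\<Sum>k=m..<n. b k\<bar> < e / 2"
    using summable unfolding summable_Cauchy by (metis half_gt_zero real_norm_def)
  have "dist (\<Sum>k<m. b k * c k x) (g x) < e" if "m \<ge> N" and x: "x \<in> X" for m x
  proof -
    have tail: "(\<lambda>k. b (k + m) * c (k + m) x) sums (g x - (\<Sum>k<m. b k * c k x))"
      using sums_split_initial_segment[OF sums[OF x]] .
    have "\<bar>\<Sum>k<n. b (k + m) * c (k + m) x\<bar> \<le> e / 2" for n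
    proof -
      have "\<bar>\<Sum>k<n. b (k + m) * c (k + m) x\<bar> \<le> e / 2 * c (0 + m) x"
      proof (rule abs_sum_mult_antimono_le)
        show "\<bar>\<Sum>k<j. b (k + m)\<bar> \<le> e / 2" for j
          using N[OF \<open>m \<ge> N\<close>, of "j + m"] sum.shift_bounds_nat_ivl[of b 0 m j]
          by (simp add: atLeast0LessThan)
        show "antimono (\<lambda>k. c (k + m) x)"
          using anti[OF x] by (auto simp: antimono_def)
      qed (use range[OF x] in auto)
      also have "\<dots> \<le> e / 2 * 1"
        using range[OF x] \<open>e > 0\<close> by (intro mult_left_mono) auto
      finally show ?thesis by simp
    qed
    then have "\<bar>g x - (\<Sum>k<m. b k * c k x)\<bar> \<le> e / 2"
      using tail unfolding sums_def by (intro LIMSEQ_le_const2[OF tendsto_rabs]) auto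
    then show ?thesis using \<open>e > 0\<close> unfolding dist_real_def by linarith
  qed
  then show "\<exists>N. \<forall>n\<ge>N. \<forall>x\<in>X. dist (\<Sum>k<n. b k * c k x) (g x) < e" by blast
qed

text \<open>
  Uniform convergence makes the integrals of the partial sums converge to the integral of the
  limit. Those integrals are the partial sums of the moment series, so the latter converges
  even where no absolute bound on its terms is at hand. The moments \<open>\<mu>\<close> stay abstract
  so that sine and cosine are both instances of \<open>\<phi>\<close>.
\<close>

lemma integral_odd_power_series_compose:
  fixes g \<phi> :: "real \<Rightarrow> real" and a \<mu> :: "nat \<Rightarrow> real"
  assumes series: "\<And>x. x \<in> {0..1} \<Longrightarrow> (\<lambda>k. a (2 * k + 1) * x ^ (2 * k + 1)) sums g x"
    and cont: "continuous_on {l..u} \<phi>"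
    and range: "\<And>x. x \<in> {l..u} \<Longrightarrow> \<phi> x \<in> {0..1}"
    and moment: "\<And>k. ((\<lambda>x. \<phi> x ^ (2 * k + 1)) has_integral \<mu> k) {l..u}"
  shows "(\<lambda>x. g (\<phi> x)) integrable_on {l..u}"
    and "(\<lambda>k. a (2 * k + 1) * \<mu> k) sums integral {l..u} (\<lambda>x. g (\<phi> x))"
proof -
  let ?S = "\<lambda>n x. \<Sum>k<n. a (2 * k + 1) * \<phi> x ^ (2 * k + 1)"
  have lim: "uniform_limit {l..u} ?S (\<lambda>x. g (\<phi> x)) sequentially"
  proof (rule uniform_limit_Abel_test)
    show "summable (\<lambda>k. a (2 * k + 1))"
      using sums_summable[OF series[of 1]] by simp
    show "antimono (\<lambda>k. \<phi> x ^ (2 * k + 1))" if "x \<in> {l..u}" for x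
      using range[OF that] by (intro antimonoI power_decreasing) auto
    show "0 \<le> \<phi> x ^ (2 * k + 1) \<and> \<phi> x ^ (2 * k + 1) \<le> 1" if "x \<in> {l..u}" for k x
      using range[OF that] power_le_one[of "\<phi> x" "2 * k + 1"] by simp
    show "(\<lambda>k. a (2 * k + 1) * \<phi> x ^ (2 * k + 1)) sums g (\<phi> x)" if "x \<in> {l..u}" for x
      using series range[OF that] by blast
  qed
  have "continuous_on {l..u} (?S n)" for n
    by (intro continuous_intros cont)
  then obtain I J where I: "\<And>n. (?S n has_integral I n) {l..u}"
    and J: "((\<lambda>x. g (\<phi> x)) has_integral J) {l..u}" and "I \<longlonglongrightarrow> J"
    using uniform_limit_integral[OF lim _ sequentially_bot] by blast
  have "(?S n has_integral (\<Sum>k<n. a (2 * k + 1) * \<mu> k)) {l..u}" for n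
    by (intro has_integral_sum has_integral_mult_right moment) auto
  then have "I = (\<lambda>n. \<Sum>k<n. a (2 * k + 1) * \<mu> k)"
    using I has_integral_unique by blast
  with \<open>I \<longlonglongrightarrow> J\<close> J
  show "(\<lambda>x. g (\<phi> x)) integrable_on {l..u}"
    and "(\<lambda>k. a (2 * k + 1) * \<mu> k) sums integral {l..u} (\<lambda>x. g (\<phi> x))"
    by (auto simp: sums_def integrable_on_def integral_unique)
qed

lemma even_odd_ratio_0: "even_odd_ratio 0 = 1"
  by (simp add: even_odd_ratio_def)

lemma even_odd_ratio_Suc:
  "even_odd_ratio (Suc k) = even_odd_ratio k * real (2 * k + 2) / real (2 * k + 3)"
  by (simp add: even_odd_ratio_def field_simps)

text \<open>
  The function \<open>- cos x * sin x ^ (n + 1)\<close> vanishes at both ends of \<open>[0, \<pi>/2]\<close>, so its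
  derivative \<open>(n + 2) * sin x ^ (n + 2) - (n + 1) * sin x ^ n\<close> integrates to zero. For
  \<open>n = 2 * k + 1\<close> this is the recurrence \<open>even_odd_ratio_Suc\<close>.
\<close>

lemma has_integral_sin_odd_power:
  "((\<lambda>x. sin x ^ (2 * k + 1)) has_integral even_odd_ratio k) {0..pi / 2}"
proof (induction k)
  case 0
  have "(sin has_integral (- cos (pi / 2) - (- cos 0))) {0..pi / 2}"
    by (rule fundamental_theorem_of_calculus)
       (auto intro!: derivative_eq_intros simp: has_real_derivative_iff_has_vector_derivative[symmetric])
  then show ?case by (simp add: even_odd_ratio_0)
next
  case (Suc k)
  define n where "n = 2 * k + 1"
  let ?F = "\<lambda>x. - cos x * sin x ^ (n + 1) :: real"
  let ?f = "\<lambda>x. real (n + 2) * sin x ^ (n + 2) - real (n + 1) * sin x ^ n"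
  have "(?F has_real_derivative ?f x) (at x within A)" for x A
  proof -
    have "(?F has_real_derivative (sin x * sin x ^ (n + 1)
        - real (n + 1) * sin x ^ n * (cos x)\<^sup>2)) (at x within A)"
      by (rule derivative_eq_intros refl)+ (simp add: power2_eq_square)
    moreover have "sin x * sin x ^ (n + 1) - real (n + 1) * sin x ^ n * (cos x)\<^sup>2 = ?f x"
      unfolding cos_squared_eq by (simp add: algebra_simps power2_eq_square)
    ultimately show ?thesis by simp
  qed
  then have "(?f has_integral (?F (pi / 2) - ?F 0)) {0..pi / 2}"
    by (intro fundamental_theorem_of_calculus)
       (auto simp: has_real_derivative_iff_has_vector_derivative[symmetric])
  then have "(?f has_integral 0) {0..pi / 2}" by simp
  moreover have "((\<lambda>x. real (n + 1) * sin x ^ n) has_integral real (n + 1) * even_odd_ratio k) {0..pi / 2}"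
    using Suc.IH unfolding n_def by (rule has_integral_mult_right)
  ultimately have "((\<lambda>x. ?f x + real (n + 1) * sin x ^ n)
      has_integral (0 + real (n + 1) * even_odd_ratio k)) {0..pi / 2}"
    by (rule has_integral_add)
  then have "((\<lambda>x. real (n + 2) * sin x ^ (n + 2)) has_integral (real (n + 1) * even_odd_ratio k)) {0..pi / 2}"
    by simp
  from has_integral_mult_right[OF this, of "1 / real (n + 2)"]
  have "((\<lambda>x. sin x ^ (n + 2)) has_integral (real (n + 1) * even_odd_ratio k / real (n + 2))) {0..pi / 2}"
    by simp
  then show ?case
    unfolding even_odd_ratio_Suc n_def by (simp add: mult.commute add.commute)
qed

lemma has_integral_cos_odd_power:
  "((\<lambda>x. cos x ^ (2 * k + 1)) has_integral even_odd_ratio k) {0..pi / 2}"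
proof -
  have "(\<lambda>x. pi / 2 - x) ` {0..pi / 2} = {0..pi / 2}"
    by simp
  with has_integral_affinity[of "\<lambda>x. sin x ^ (2 * k + 1)" _ 0 "pi / 2" "-1" "pi / 2"]
    has_integral_sin_odd_power[of k]
  show ?thesis by (simp add: cos_sin_eq)
qed

theorem theorem4:
  fixes g :: "real \<Rightarrow> real" and a :: "nat \<Rightarrow> real"
  assumes g_series: "\<And>x. x \<in> {0..1} \<Longrightarrow> (\<lambda>k. a (2 * k + 1) * x ^ (2 * k + 1)) sums g x"
  shows "(\<lambda>x. g (sin x)) integrable_on {0..pi / 2} \<and>
         (\<lambda>x. g (cos x)) integrable_on {0..pi / 2} \<and>
         summable (\<lambda>n. a (2 * (n + 1) + 1) * even_odd_ratio (n + 1)) \<and>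
         integral {0..pi / 2} (\<lambda>x. g (sin x)) = integral {0..pi / 2} (\<lambda>x. g (cos x)) \<and>
         integral {0..pi / 2} (\<lambda>x. g (cos x)) =
           a 1 + (\<Sum>n. a (2 * (n + 1) + 1) * even_odd_ratio (n + 1))"
proof -
  let ?t = "\<lambda>k. a (2 * k + 1) * even_odd_ratio k"
  have "sin x \<in> {0..1}" "cos x \<in> {0..1}" if "x \<in> {0..pi / 2}" for x :: real
    using that by (auto intro!: sin_ge_zero cos_ge_zero)
  then have sin: "(\<lambda>x. g (sin x)) integrable_on {0..pi / 2}" "?t sums integral {0..pi / 2} (\<lambda>x. g (sin x))"
    and cos: "(\<lambda>x. g (cos x)) integrable_on {0..pi / 2}" "?t sums integral {0..pi / 2} (\<lambda>x. g (cos x))"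
    using integral_odd_power_series_compose[OF g_series _ _ has_integral_sin_odd_power]
      integral_odd_power_series_compose[OF g_series _ _ has_integral_cos_odd_power]
    by (simp_all add: continuous_on_sin continuous_on_cos)
  have "(\<lambda>n. ?t (n + 1)) sums (integral {0..pi / 2} (\<lambda>x. g (cos x)) - a 1)"
    using sums_split_initial_segment[OF cos(2), of 1] by (simp add: even_odd_ratio_0)
  with sin cos show ?thesis
    using sums_unique2[OF sin(2) cos(2)] by (simp add: sums_iff)
qed

end
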